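(* Let $\alpha \in \mathbb{T} = \mathbb{R}/\mathbb{Z}$ be irrational, let $\Omega = \mathbb{T} \times \mathbb{Z}_2$ carry the product probability measure $\mu$ of Lebesgue measure on $\mathbb{T}$ and the uniform measure on $\mathbb{Z}_2$, and let $T : \Omega \to \Omega$, $T(\theta,j) = (\theta + \alpha, j+1)$. For every $\varepsilon \in (0, \frac{1}{\sqrt{2}})$, every integer $k \ge 1$, and all $a_{-k}, \ldots, a_{k-1} \in \mathbb{C}$, there is $\lambda_1 > 0$ such that for every $\lambda \in \mathbb{C}$ with $|\lambda| < \lambda_1$ the following holds: the function $$ f_\lambda(\theta,j) = \begin{cases} (1 - \varepsilon^2)^{1/2} \left( e^{2 \pi i k \theta} + \lambda \sum_{l = -k}^{k-1} a_l e^{2 \pi i l \theta} \right) & j = 0, \\ (1 - \varepsilon^2)^{1/2} \left( e^{- 2 \pi i k \theta} + \lambda \sum_{l = -k}^{k-1} a_l e^{- 2 \pi i l \theta} \right) & j = 1, \end{cases} $$ maps $\Omega$ into $\mathbb{D}$, and there is $\gamma_- > 0$ for which the Lyapunov exponent $\gamma(z)$, $z \in \partial\mathbb{D}$, of the Szegő cocycle $A^z$ over $T$ associated with $f = f_\lambda$ satisfies $$ \inf_{z \in \partial \mathbb{D}} \gamma(z) \ge \gamma_- . $$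
   Context: $\mathbb{D}$ is the open unit disk in $\mathbb{C}$ and $\partial \mathbb{D}$ is the unit circle. $\mathbb{Z}_2 = \{0,1\}$ is the group with two elements, with each element given probability $\frac12$. The transformation $T$ is ergodic with respect to $\mu$. Szegő cocycle: for a measurable $f : \Omega \to \mathbb{D}$ with $\int_\Omega \log(1 - |f|)\, d\mu > -\infty$ and $z \in \partial \mathbb{D}$, define $$ A^z(\omega) = (1 - |f(\omega)|^2)^{-1/2} \begin{pmatrix} z & - \overline{f(\omega)} \\ - f(\omega) z & 1 \end{pmatrix}, \qquad \omega \in \Omega, $$ and $A^z_n(\omega) = A^z(T^{n-1}\omega) \cdots A^z(T\omega) A^z(\omega)$ for $n \ge 1$. Lyapunov exponent: $$ \gamma(z) = \lim_{n \to \infty} \frac1n \int_\Omega \log \| A^z_n(\omega) \| \, d\mu(\omega), $$ where $\|\cdot\|$ is the operator norm on $2 \times 2$ complex matrices; the limit exists by subadditivity (Kingman's theorem). *)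

theory Defs
  imports "HOL-Probability.Probability" "HOL-Library.Z2"
begin

text \<open>Szego cocycles over a transformation \<open>T\<close> with sampling function \<open>f\<close>, valued in the open
  unit disk. All definitions are total; they carry their intended meaning when \<open>f\<close> maps
  the base space into \<open>ball 0 1\<close>.\<close>

definition szego_matrix :: "complex \<Rightarrow> complex \<Rightarrow> complex^2^2" where
  "szego_matrix z a =
     (1 - (cmod a)\<^sup>2) powr (- 1 / 2) *\<^sub>R
       vector [vector [z, - cnj a], vector [- a * z, 1]]"

text \<open>\<open>szego_cocycle T f z n \<omega>\<close> is the product
  \<open>A (T^(n-1) \<omega>) ** \<dots> ** A (T \<omega>) ** A \<omega>\<close> with \<open>A \<omega> = szego_matrix z (f \<omega>)\<close>.\<close>

primrec szego_cocycle ::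
    "('w \<Rightarrow> 'w) \<Rightarrow> ('w \<Rightarrow> complex) \<Rightarrow> complex \<Rightarrow> nat \<Rightarrow> 'w \<Rightarrow> complex^2^2" where
  "szego_cocycle T f z 0 \<omega> = mat 1"
| "szego_cocycle T f z (Suc n) \<omega> =
     szego_matrix z (f ((T ^^ n) \<omega>)) ** szego_cocycle T f z n \<omega>"

text \<open>The norm on \<open>complex^2\<close> is the Euclidean one, so \<open>onorm\<close> is the usual operator norm.\<close>

definition lyapunov_exponent ::
    "'w measure \<Rightarrow> ('w \<Rightarrow> 'w) \<Rightarrow> ('w \<Rightarrow> complex) \<Rightarrow> complex \<Rightarrow> real" where
  "lyapunov_exponent M T f z =
     lim (\<lambda>n. 1 / real n * (\<integral>\<omega>. ln (onorm ((*v) (szego_cocycle T f z n \<omega>))) \<partial>M))"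

text \<open>The circle \<open>\<real>/\<int>\<close> is represented by its fundamental domain \<open>[0, 1)\<close>, with addition taken
  modulo one through \<open>frac\<close>.\<close>

definition circle_Z2 :: "(real \<times> bit) measure" where
  "circle_Z2 = restrict_space lborel {0..<1} \<Otimes>\<^sub>M uniform_count_measure {0, 1}"

definition circle_Z2_shift :: "real \<Rightarrow> real \<times> bit \<Rightarrow> real \<times> bit" where
  "circle_Z2_shift \<alpha> = (\<lambda>(\<theta>, j). (frac (\<theta> + \<alpha>), j + 1))"

definition fourier_char :: "int \<Rightarrow> real \<Rightarrow> complex" where
  "fourier_char l \<theta> = exp (2 * of_real pi * \<i> * of_int l * of_real \<theta>)"

definition sampling_fun ::
    "real \<Rightarrow> int \<Rightarrow> (int \<Rightarrow> complex) \<Rightarrow> complex \<Rightarrow> real \<times> bit \<Rightarrow> complex" where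
  "sampling_fun \<epsilon> k a c = (\<lambda>(\<theta>, j).
     if j = 0
     then of_real (sqrt (1 - \<epsilon>\<^sup>2)) *
            (fourier_char k \<theta> + c * (\<Sum>l = -k..k - 1. a l * fourier_char l \<theta>))
     else of_real (sqrt (1 - \<epsilon>\<^sup>2)) *
            (fourier_char (- k) \<theta> + c * (\<Sum>l = -k..k - 1. a l * fourier_char (- l) \<theta>)))"

lemma space_circle_Z2: "space circle_Z2 = {0..<1} \<times> UNIV"
proof -
  have "x = 0 \<or> x = 1" for x :: bit
    by (cases x) auto
  then show ?thesis
    by (auto simp: circle_Z2_def space_pair_measure space_restrict_space
        uniform_count_measure_def space_point_measure)
qed

lemma prob_space_circle_Z2: "prob_space circle_Z2"
proof -
  interpret A: prob_space "restrict_space lborel {0..<1::real}"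
    by (rule prob_spaceI) (simp add: emeasure_restrict_space space_restrict_space)
  interpret B: prob_space "uniform_count_measure {0, 1::bit}"
    by (rule prob_space_uniform_count_measure) auto
  interpret P: pair_prob_space "restrict_space lborel {0..<1::real}" "uniform_count_measure {0, 1::bit}" ..
  show ?thesis
    unfolding circle_Z2_def by (rule P.prob_space_axioms)
qed

lemma szego_matrix_entries:
  "szego_matrix z a $ 1 $ 1 = (1 - (cmod a)\<^sup>2) powr (- 1 / 2) *\<^sub>R z"
  "szego_matrix z a $ 1 $ 2 = (1 - (cmod a)\<^sup>2) powr (- 1 / 2) *\<^sub>R (- cnj a)"
  "szego_matrix z a $ 2 $ 1 = (1 - (cmod a)\<^sup>2) powr (- 1 / 2) *\<^sub>R (- a * z)"
  "szego_matrix z a $ 2 $ 2 = (1 - (cmod a)\<^sup>2) powr (- 1 / 2) *\<^sub>R 1"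
  by (simp_all add: szego_matrix_def)

end

theory Submission
  imports Defs "HOL-Complex_Analysis.Complex_Analysis"
    "HOL-Computational_Algebra.Fundamental_Theorem_Algebra"
begin

text \<open>Herman's subharmonicity argument. With \<open>w = exp (2 \<pi> \<i> \<theta>)\<close>, the Szego matrix without its normalization
  becomes a polynomial in \<open>w\<close> after multiplication by \<open>w\<^sup>k\<close>. At \<open>w = 0\<close> only the two coefficients of
  modulus \<open>r = sqrt (1 - \<epsilon>\<^sup>2)\<close> in \<open>f(\<theta>, 1)\<close> and in the conjugate of \<open>f(\<theta>, 0)\<close> matter, so a suitable
  unit vector is multiplied by \<open>r\<close> in each step, independently of \<open>\<lambda>\<close>, \<open>z\<close> and \<open>\<alpha>\<close>. Jensen's inequality carries
  this over to the unit circle. The normalization contributes a factor of at least \<open>1 / sqrt D\<close> per step,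
  where \<open>1 - |f|\<^sup>2 \<le> D\<close>, and \<open>D < r\<^sup>2\<close> for small \<open>\<lambda>\<close> because \<open>\<epsilon>\<^sup>2 < 1 - \<epsilon>\<^sup>2\<close>. Hence
  \<open>\<gamma>(z) \<ge> ln (r / sqrt D) > 0\<close>.\<close>

subsection \<open>Jensen's inequality for polynomials\<close>

lemma fourier_char_eq_cis: "fourier_char l \<theta> = cis (2 * pi * l * \<theta>)"
  by (simp add: fourier_char_def cis_conv_exp mult_ac)

lemma norm_fourier_char [simp]: "cmod (fourier_char l \<theta>) = 1"
  by (simp add: fourier_char_eq_cis)

lemma fourier_char_nonzero [simp]: "fourier_char l \<theta> \<noteq> 0"
  using norm_fourier_char[of l \<theta>] by fastforce

lemma cnj_fourier_char: "cnj (fourier_char l \<theta>) = fourier_char (- l) \<theta>"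
  by (simp add: fourier_char_eq_cis cis_cnj)

lemma fourier_char_mult: "fourier_char l \<theta> * fourier_char m \<theta> = fourier_char (l + m) \<theta>"
  by (simp add: fourier_char_eq_cis cis_mult algebra_simps)

lemma fourier_char_add: "fourier_char l (s + t) = fourier_char l s * fourier_char l t"
  by (simp add: fourier_char_eq_cis cis_mult algebra_simps)

lemma fourier_char_nat: "0 \<le> l \<Longrightarrow> fourier_char l \<theta> = fourier_char 1 \<theta> ^ nat l"
  by (simp add: fourier_char_eq_cis Complex.DeMoivre mult_ac)

lemma fourier_char_of_int [simp]: "fourier_char l (of_int m) = 1"
  using cis_multiple_2pi[of "of_int (l * m)"] by (simp add: fourier_char_eq_cis mult_ac)

lemma fourier_char_frac: "fourier_char l (frac \<theta>) = fourier_char l \<theta>"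
  using fourier_char_add[of l "frac \<theta>" "of_int \<lfloor>\<theta>\<rfloor>"] by (simp add: frac_def)

lemma continuous_on_fourier_char [continuous_intros]:
  "continuous_on S g \<Longrightarrow> continuous_on S (\<lambda>x. fourier_char l (g x))"
  unfolding fourier_char_def by (intro continuous_intros)

lemma circlepath_fourier_char: "circlepath 0 1 = fourier_char 1"
  by (auto simp: circlepath fourier_char_def fun_eq_iff)

text \<open>Mean value property: the integrand is the real part of \<open>Ln (1 - b * w)\<close> on
  the unit circle. This function is holomorphic on the closed disk because \<open>1 - b * w\<close>
  has positive real part there, and it vanishes at the centre.\<close>

lemma has_integral_ln_norm_one_minus:
  assumes "cmod b < 1"
  shows "((\<lambda>\<theta>. ln (cmod (1 - b * fourier_char 1 \<theta>))) has_integral 0) {0..1}"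
proof -
  have "cmod (b * w) < 1" if "w \<in> cball 0 1" for w
    using assms that mult_mono[of "cmod b" "cmod b" "cmod w" 1] by (simp add: norm_mult)
  then have re: "0 < Re (1 - b * w)" if "w \<in> cball 0 1" for w
    using that complex_Re_le_cmod[of "b * w"] by fastforce
  have "(\<lambda>w. Ln (1 - b * w)) holomorphic_on cball 0 1"
    using re by (intro holomorphic_intros) (metis complex_nonpos_Reals_iff not_less)
  \<comment> \<open>Cauchy's formula at the centre gives \<open>2 * pi * \<i> * Ln 1\<close>, which
    is 0.\<close>
  from Cauchy_integral_circlepath_simple[OF this, of 0]
  have "((\<lambda>u. Ln (1 - b * u) / u) has_contour_integral 0) (circlepath 0 1)"
    by simp
  moreover have vd: "vector_derivative (fourier_char 1) (at x within {0..1}) =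
      2 * pi * \<i> * fourier_char 1 x" if "x \<in> {0..1}" for x
    using vector_derivative_circlepath01[of x 0 1] that
    by (simp add: circlepath_fourier_char) (simp add: fourier_char_def)
  ultimately have "((\<lambda>x. Ln (1 - b * fourier_char 1 x) / fourier_char 1 x *
      (2 * pi * \<i> * fourier_char 1 x)) has_integral 0) {0..1}"
    unfolding has_contour_integral_def circlepath_fourier_char
    by (metis (no_types, lifting) has_integral_cong)
  then have "((\<lambda>x. inverse (2 * pi * \<i>) * (Ln (1 - b * fourier_char 1 x) / fourier_char 1 x *
      (2 * pi * \<i> * fourier_char 1 x))) has_integral inverse (2 * pi * \<i>) * 0) {0..1}"
    by (rule has_integral_mult_right)
  then have "((\<lambda>x. Ln (1 - b * fourier_char 1 x)) has_integral 0) {0..1}"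
    by (simp add: field_simps)
  from has_integral_Re[OF this]
  have "((\<lambda>x. Re (Ln (1 - b * fourier_char 1 x))) has_integral 0) {0..1}"
    by simp
  then show ?thesis
  proof (rule has_integral_eq[rotated])
    fix x :: real
    have "1 - b * fourier_char 1 x \<noteq> 0"
      using re[of "fourier_char 1 x"] by fastforce
    then show "Re (Ln (1 - b * fourier_char 1 x)) = ln (cmod (1 - b * fourier_char 1 x))"
      by simp
  qed
qed

text \<open>A zero inside the disk is reflected: on the unit circle \<open>w - z\<close> and
  \<open>1 - cnj z * w\<close> have the same modulus. A zero outside is factored out, leaving
  \<open>1 - inverse z * w\<close>. Both cases reduce to a logarithm with mean 0.\<close>

lemma has_integral_ln_norm_diff:
  assumes "cmod z \<noteq> 1"
  shows "((\<lambda>\<theta>. ln (cmod (fourier_char 1 \<theta> - z))) has_integral max 0 (ln (cmod z))) {0..1}"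
proof (cases "cmod z < 1")
  case True
  have eq: "cmod (1 - cnj z * fourier_char 1 \<theta>) = cmod (fourier_char 1 \<theta> - z)" for \<theta>
  proof -
    have "cnj (1 - cnj z * fourier_char 1 \<theta>) * fourier_char 1 \<theta> = fourier_char 1 \<theta> - z"
      using fourier_char_mult[of "-1" \<theta> 1]
      by (simp add: cnj_fourier_char algebra_simps) (simp add: fourier_char_def)
    then show ?thesis
      by (metis complex_mod_cnj mult.right_neutral norm_fourier_char norm_mult)
  qed
  \<comment> \<open>A zero at the origin belongs to this case as well, through the default value of
    \<open>ln 0\<close>.\<close>
  have "max 0 (ln (cmod z)) = 0"
    using True by (cases "z = 0") (auto simp: max_def ln_le_zero_iff)
  with has_integral_ln_norm_one_minus[of "cnj z"] True show ?thesis
    by (simp add: eq)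
next
  case False
  with assms have z: "1 < cmod z" by simp
  then have z0: "z \<noteq> 0" by auto
  have "((\<lambda>\<theta>. ln (cmod z) + ln (cmod (1 - inverse z * fourier_char 1 \<theta>)))
      has_integral ln (cmod z) + 0) {0..1}"
    using has_integral_const_real[of "ln (cmod z)" 0 1]
    by (intro has_integral_add has_integral_ln_norm_one_minus)
       (use z in \<open>simp_all add: norm_inverse inverse_less_1_iff\<close>)
  then have "((\<lambda>\<theta>. ln (cmod (fourier_char 1 \<theta> - z))) has_integral ln (cmod z) + 0) {0..1}"
  proof (rule has_integral_eq[rotated])
    fix \<theta> :: real
    have ne: "1 - inverse z * fourier_char 1 \<theta> \<noteq> 0"
      using z z0 by (auto simp: field_simps)
    have "ln (cmod z) + ln (cmod (1 - inverse z * fourier_char 1 \<theta>)) =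
        ln (cmod (z * (1 - inverse z * fourier_char 1 \<theta>)))"
      using ne z0 by (simp add: norm_mult ln_mult)
    also have "z * (1 - inverse z * fourier_char 1 \<theta>) = z - fourier_char 1 \<theta>"
      using z0 by (simp add: field_simps)
    finally show "ln (cmod z) + ln (cmod (1 - inverse z * fourier_char 1 \<theta>)) =
        ln (cmod (fourier_char 1 \<theta> - z))"
      by (simp add: norm_minus_commute)
  qed
  moreover have "max 0 (ln (cmod z)) = ln (cmod z) + 0"
    using z by (simp add: max_def)
  ultimately show ?thesis by simp
qed

text \<open>Induction on the degree, splitting off one root \<open>z\<close> at a time: it
  contributes \<open>max 0 (ln (cmod z))\<close> to the integral, but only
  \<open>ln (cmod z)\<close> to the value at the origin.\<close>

lemma jensen_poly_no_zeros_on_circle: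
  assumes "poly p 0 \<noteq> 0" and "\<And>w. cmod w = 1 \<Longrightarrow> poly p w \<noteq> 0"
  shows "\<exists>I \<ge> ln (cmod (poly p 0)).
    ((\<lambda>\<theta>. ln (cmod (poly p (fourier_char 1 \<theta>)))) has_integral I) {0..1}"
  using assms
proof (induction "degree p" arbitrary: p)
  case 0
  then obtain c where p: "p = [:c:]"
    by (metis degree_eq_zeroE)
  show ?case
    using has_integral_const_real[of "ln (cmod c)" 0 1] by (auto simp: p)
next
  case (Suc n)
  then obtain z where "poly p z = 0"
    using Fundamental_Theorem_Algebra.fundamental_theorem_of_algebra[of p] Suc.hyps(2)
    by (auto simp: constant_degree)
  then obtain q where p: "p = [:- z, 1:] * q"
    by (metis dvdE poly_eq_0_iff_dvd)
  with Suc have q0: "q \<noteq> 0" by auto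
  have ne: "poly q 0 \<noteq> 0" "z \<noteq> 0" "cmod z \<noteq> 1" "\<And>w. cmod w = 1 \<Longrightarrow> poly q w \<noteq> 0"
    using Suc.prems by (auto simp: p)
  have "n = degree q"
    using Suc.hyps(2) q0 unfolding p by (subst (asm) degree_mult_eq) auto
  from Suc.hyps(1)[OF this] ne obtain I where I: "I \<ge> ln (cmod (poly q 0))"
    "((\<lambda>\<theta>. ln (cmod (poly q (fourier_char 1 \<theta>)))) has_integral I) {0..1}"
    by blast
  have "((\<lambda>\<theta>. ln (cmod (fourier_char 1 \<theta> - z)) + ln (cmod (poly q (fourier_char 1 \<theta>))))
      has_integral max 0 (ln (cmod z)) + I) {0..1}"
    by (intro has_integral_add has_integral_ln_norm_diff I ne)
  then have "((\<lambda>\<theta>. ln (cmod (poly p (fourier_char 1 \<theta>))))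
      has_integral max 0 (ln (cmod z)) + I) {0..1}"
  proof (rule has_integral_eq[rotated])
    fix \<theta> :: real
    have "fourier_char 1 \<theta> - z \<noteq> 0" using ne by auto
    moreover have "poly q (fourier_char 1 \<theta>) \<noteq> 0" using ne by simp
    moreover have "poly p (fourier_char 1 \<theta>) = (fourier_char 1 \<theta> - z) * poly q (fourier_char 1 \<theta>)"
      by (simp add: p algebra_simps)
    ultimately show "ln (cmod (fourier_char 1 \<theta> - z)) + ln (cmod (poly q (fourier_char 1 \<theta>))) =
        ln (cmod (poly p (fourier_char 1 \<theta>)))"
      by (simp add: norm_mult ln_mult)
  qed
  moreover have "ln (cmod (poly p 0)) \<le> max 0 (ln (cmod z)) + I"
    using I ne by (simp add: p norm_mult ln_mult)
  ultimately show ?case by blast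
qed

text \<open>Zeros of \<open>p\<close> on the circle are avoided by replacing \<open>p w\<close> with \<open>p (\<rho> w)\<close>, \<open>\<rho> < 1\<close>.\<close>

lemma jensen_poly_majorant:
  assumes p0: "poly p 0 \<noteq> 0"
    and cont: "continuous_on {0..1} g"
    and pos: "\<And>\<theta>. \<theta> \<in> {0..1} \<Longrightarrow> 0 < g \<theta>"
    and le: "\<And>\<theta>. \<theta> \<in> {0..1} \<Longrightarrow> cmod (poly p (fourier_char 1 \<theta>)) \<le> g \<theta>"
  shows "ln (cmod (poly p 0)) \<le> integral {0..1} (\<lambda>\<theta>. ln (g \<theta>))"
proof (rule field_le_epsilon)
  fix \<eta> :: real assume "0 < \<eta>"
  have int: "(\<lambda>\<theta>. ln (g \<theta>)) integrable_on {0..1}"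
    by (intro integrable_continuous_real continuous_intros cont) (use pos in fastforce)
  obtain x where x: "x \<in> {0..1}" "\<And>y. y \<in> {0..1} \<Longrightarrow> g x \<le> g y"
    using continuous_attains_inf[OF compact_Icc _ cont] by auto
  \<comment> \<open>The minimum of \<open>g\<close> turns the additive error
    \<open>\<eta> * m\<close> into a relative one, at most \<open>\<eta> * g \<theta>\<close>, which
    costs at most \<eta> after taking logarithms.\<close>
  define m where "m = g x"
  have m: "0 < m" using x pos by (simp add: m_def)
  have "uniformly_continuous_on (cball 0 1) (poly p)"
    by (intro compact_uniformly_continuous continuous_intros) simp
  then obtain d where d: "d > 0" "\<And>v w. v \<in> cball 0 1 \<Longrightarrow> w \<in> cball 0 1 \<Longrightarrow> dist w v < d \<Longrightarrow>
      dist (poly p w) (poly p v) < \<eta> * m"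
    unfolding uniformly_continuous_on_def using m \<open>0 < \<eta>\<close> by (metis mult_pos_pos)
  have "p \<noteq> 0" using p0 by auto
  \<comment> \<open>Only finitely many radii carry zeros of \<open>p\<close>, so some \<rho>
    arbitrarily close to 1 avoids them all.\<close>
  then have "finite (cmod ` {w. poly p w = 0})"
    by (intro finite_imageI poly_roots_finite)
  moreover have "infinite {max 0 (1 - d)<..<1}"
    using d by (intro infinite_Ioo) auto
  ultimately obtain \<rho> where \<rho>: "\<rho> \<in> {max 0 (1 - d)<..<1}" "\<rho> \<notin> cmod ` {w. poly p w = 0}"
    by (meson finite_subset subsetI)
  define q where "q = pcompose p [:0, of_real \<rho>:]"
  have q: "poly q w = poly p (of_real \<rho> * w)" for w
    by (simp add: q_def poly_pcompose mult.commute)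
  have q0: "poly q 0 = poly p 0" by (simp add: q)
  have qn: "poly q w \<noteq> 0" if "cmod w = 1" for w
  proof
    assume "poly q w = 0"
    then have "cmod (of_real \<rho> * w) \<in> cmod ` {w. poly p w = 0}"
      by (auto simp: q)
    with \<rho> that show False by (simp add: norm_mult)
  qed
  obtain I where I: "ln (cmod (poly p 0)) \<le> I"
    "((\<lambda>\<theta>. ln (cmod (poly q (fourier_char 1 \<theta>)))) has_integral I) {0..1}"
    using jensen_poly_no_zeros_on_circle[of q] qn p0 q0 by auto
  have "((\<lambda>\<theta>. ln (g \<theta>) + \<eta>) has_integral integral {0..1} (\<lambda>\<theta>. ln (g \<theta>)) + \<eta>) {0..1}"
    using has_integral_const_real[of \<eta> 0 1]
    by (intro has_integral_add) (use int in \<open>auto simp: has_integral_integral\<close>)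
  then have "I \<le> integral {0..1} (\<lambda>\<theta>. ln (g \<theta>)) + \<eta>"
  proof (rule has_integral_le[OF I(2)])
    fix \<theta> :: real assume t: "\<theta> \<in> {0..1}"
    define w where "w = fourier_char 1 \<theta>"
    have w: "cmod w = 1" by (simp add: w_def)
    have "dist (of_real \<rho> * w) w = cmod ((of_real \<rho> - 1) * w)"
      by (simp add: dist_norm algebra_simps)
    also have "\<dots> = 1 - \<rho>"
      using \<rho> norm_of_real[of "\<rho> - 1", where 'a = complex] by (simp add: norm_mult w)
    finally have "dist (poly q w) (poly p w) < \<eta> * m"
      unfolding q by (intro d) (use \<rho> w in \<open>auto simp: norm_mult\<close>)
    then have "cmod (poly q w) \<le> cmod (poly p w) + \<eta> * m"
      using norm_triangle_sub[of "poly q w" "poly p w"] by (simp add: dist_norm)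
    also have "\<dots> \<le> g \<theta> + \<eta> * g \<theta>"
      using le[OF t] x(2)[OF t] \<open>0 < \<eta>\<close> by (intro add_mono mult_left_mono) (auto simp: w_def m_def)
    finally have "cmod (poly q w) \<le> g \<theta> * (1 + \<eta>)" by (simp add: algebra_simps)
    then have "ln (cmod (poly q w)) \<le> ln (g \<theta> * (1 + \<eta>))"
      using qn[OF w] pos[OF t] \<open>0 < \<eta>\<close> by (subst ln_le_cancel_iff) auto
    also have "\<dots> = ln (g \<theta>) + ln (1 + \<eta>)"
      using pos[OF t] \<open>0 < \<eta>\<close> by (simp add: ln_mult)
    also have "\<dots> \<le> ln (g \<theta>) + \<eta>"
      using ln_add_one_self_le_self[of \<eta>] \<open>0 < \<eta>\<close> by simp
    finally show "ln (cmod (poly q (fourier_char 1 \<theta>))) \<le> ln (g \<theta>) + \<eta>"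
      by (simp add: w_def)
  qed
  with I show "ln (cmod (poly p 0)) \<le> integral {0..1} (\<lambda>\<theta>. ln (g \<theta>)) + \<eta>" by simp
qed

subsection \<open>Subadditive sequences and periodic integrals\<close>

text \<open>Fekete's lemma: the limit is the infimum of the quotients, which the linear lower bound
  keeps finite.\<close>

lemma subadditive_convergent:
  fixes u :: "nat \<Rightarrow> real"
  assumes sub: "\<And>m n. u (m + n) \<le> u m + u n"
    and low: "\<And>n. c * real n \<le> u n"
  shows "convergent (\<lambda>n. u n / real n)"
proof -
  define L where "L = (INF n\<in>{1..}. u n / real n)"
  have bdd: "bdd_below ((\<lambda>n. u n / real n) ` {1..})"
    using low by (intro bdd_belowI2[of _ c]) (auto simp: field_simps)
  have mult: "u (q * m + s) \<le> real q * u m + u s" for q m s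
  proof (induction q)
    case (Suc q)
    have "u (Suc q * m + s) \<le> u m + u (q * m + s)"
      using sub[of m "q * m + s"] by (simp add: add.assoc)
    with Suc show ?case by (simp add: algebra_simps)
  qed simp
  have "(\<lambda>n. u n / real n) \<longlonglongrightarrow> L"
  proof (rule LIMSEQ_I)
    fix e :: real assume e: "0 < e"
    have "\<exists>m\<in>{1..}. u m / real m < L + e / 2"
      using cINF_less_iff[OF _ bdd, of "L + e/2"] e by (auto simp: L_def)
    then obtain m where m: "1 \<le> m" "u m / real m < L + e / 2" by auto
    \<comment> \<open>\<open>B\<close> bounds the contribution of the remainder in the division of
      \<open>n\<close> by \<open>m\<close>, uniformly in \<open>n\<close>. Dividing by
      \<open>n\<close> makes it smaller than \<open>e / 2\<close>.\<close>
    define B where "B = Max ((\<lambda>s. \<bar>u s - real s * (u m / real m)\<bar>) ` {..<m})"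
    have B: "\<bar>u s - real s * (u m / real m)\<bar> \<le> B" if "s < m" for s
      unfolding B_def using that by (intro Max_ge) auto
    obtain N where N: "2 * B / e < real N" using reals_Archimedean2 by blast
    show "\<exists>no. \<forall>n\<ge>no. norm (u n / real n - L) < e"
    proof (intro exI allI impI)
      fix n assume n: "max 1 N \<le> n"
      have ge: "L \<le> u n / real n"
        unfolding L_def using n by (intro cINF_lower[OF bdd]) auto
      have "u n = u (n div m * m + n mod m)" by simp
      also have "\<dots> \<le> real (n div m) * u m + u (n mod m)" by (rule mult)
      also have "real (n div m) * u m = (real (n div m) * real m) * (u m / real m)"
        using m by simp
      also have "real (n div m) * real m = real n - real (n mod m)"
        by (metis add_diff_cancel_right' div_mult_mod_eq of_nat_add of_nat_mult)
      finally have "u n \<le> real n * (u m / real m) + (u (n mod m) - real (n mod m) * (u m / real m))"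
        by (simp add: algebra_simps)
      also have "\<dots> \<le> real n * (u m / real m) + B"
        using B[of "n mod m"] m by auto
      also have "B < real n * (e / 2)"
      proof -
        have "2 * B / e < real n" using N n by simp
        then show ?thesis using e by (simp add: field_simps)
      qed
      finally have "u n < real n * (u m / real m + e / 2)" by (simp add: algebra_simps)
      then have "u n / real n < u m / real m + e / 2"
        using n by (simp add: field_simps)
      with m ge show "norm (u n / real n - L) < e" by simp
    qed
  qed
  then show ?thesis by (rule convergentI)
qed

text \<open>By periodicity \<open>c\<close> may be replaced by its fractional part \<open>d\<close>.
  The shifted interval from \<open>d\<close> to \<open>1 + d\<close> is then cut at 1, and the piece
  beyond 1 is moved back by one period.\<close>

lemma integral_periodic_shift:
  fixes g :: "real \<Rightarrow> real"
  assumes cont: "continuous_on UNIV g" and per: "\<And>x. g (x + 1) = g x"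
  shows "integral {0..1} (\<lambda>x. g (x + c)) = integral {0..1} g"
proof -
  have int: "g integrable_on {a..b}" for a b
    by (rule integrable_continuous_real) (rule continuous_on_subset[OF cont], simp)
  have shift: "integral {a..b} (\<lambda>x. g (x + d)) = integral {a + d..b + d} g" for a b d
    using integral_shift[of a d b g] continuous_on_subset[OF cont] by (simp add: o_def add.commute)
  have per': "integral {a + 1..b + 1} g = integral {a..b} g" for a b
    using shift[of a b 1] by (simp add: per)
  have pn: "g (x + of_int n) = g x" for x n
  proof (induction n rule: int_induct[of _ 0])
    case (step1 i) then show ?case using per[of "x + of_int i"] by (simp add: add.assoc)
  next
    case (step2 i) then show ?case using per[of "x + of_int i - 1"] by (simp add: algebra_simps)
  qed simp
  define d where "d = frac c"
  have d: "0 \<le> d" "d \<le> 1" by (auto simp: d_def frac_lt_1 less_imp_le)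
  have "integral {0..1} (\<lambda>x. g (x + c)) = integral {0..1} (\<lambda>x. g (x + d))"
  proof (rule integral_cong)
    fix x :: real
    have "x + c = x + d + of_int \<lfloor>c\<rfloor>" by (simp add: d_def frac_def)
    then show "g (x + c) = g (x + d)" by (metis pn)
  qed
  also have "\<dots> = integral {d..1} g + integral {1..1 + d} g"
    using shift[of 0 1 d] d by (simp add: Henstock_Kurzweil_Integration.integral_combine int)
  also have "integral {1..1 + d} g = integral {0..d} g"
    using per'[of 0 d] by (simp add: add.commute)
  also have "integral {d..1} g + integral {0..d} g = integral {0..1} g"
    using Henstock_Kurzweil_Integration.integral_combine[of 0 d 1 g] d int by (simp add: add.commute)
  finally show ?thesis .
qed

subsection \<open>Szego cocycles over the rotation\<close>

lemma bit_cases: "(b :: bit) = 0 \<or> b = 1"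
  by (cases b) auto

lemma bit_1_plus_1: "(1 :: bit) + 1 = 0"
  by simp

text \<open>Fubini over the two sheets, followed by the passage from Lebesgue integrals over the
  half-open interval to gauge integrals over the closed one, to which the circle estimates
  apply.\<close>

lemma integral_circle_Z2:
  fixes h :: "real \<times> bit \<Rightarrow> real"
  assumes cont: "\<And>j. continuous_on UNIV (\<lambda>\<theta>. h (\<theta>, j))"
  shows "(\<integral>\<omega>. h \<omega> \<partial>circle_Z2) =
    (integral {0..1} (\<lambda>\<theta>. h (\<theta>, 0)) + integral {0..1} (\<lambda>\<theta>. h (\<theta>, 1))) / 2"
proof -
  let ?A = "restrict_space lborel {0..<1::real}" and ?B = "uniform_count_measure {0, 1::bit}"
  interpret A: prob_space ?A
    by (rule prob_spaceI) (simp add: emeasure_restrict_space space_restrict_space)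
  interpret B: prob_space ?B
    by (rule prob_space_uniform_count_measure) auto
  interpret P: pair_prob_space ?A ?B ..
  have [measurable]: "(\<lambda>\<theta>. h (\<theta>, j)) \<in> borel_measurable ?A" for j
    using borel_measurable_continuous_onI[OF cont[of j]] by (simp add: measurable_restrict_space1)
  have [measurable]: "Measurable.pred ?B (\<lambda>j. j = 0)"
    by (auto simp: uniform_count_measure_def space_point_measure sets_point_measure pred_def)
  \<comment> \<open>Only the sections of \<open>h\<close> are known to be measurable, so joint
    measurability is read off from a form of \<open>h\<close> that distinguishes the two
    sheets.\<close>
  have "(\<lambda>\<omega>. if snd \<omega> = 0 then h (fst \<omega>, 0) else h (fst \<omega>, 1)) \<in> borel_measurable (?A \<Otimes>\<^sub>M ?B)"
    by measurable
  also have "(\<lambda>\<omega>. if snd \<omega> = 0 then h (fst \<omega>, 0) else h (fst \<omega>, 1)) = h"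
    using bit_cases by (auto simp: fun_eq_iff)
  finally have meas: "h \<in> borel_measurable (?A \<Otimes>\<^sub>M ?B)" .
  have "\<exists>K. \<forall>\<theta>\<in>{0..1}. norm (h (\<theta>, j)) \<le> K" for j
    using compact_imp_bounded[OF compact_continuous_image[OF continuous_on_subset[OF cont[of j]], of "{0..1}"]]
    by (auto simp: bounded_iff)
  then obtain K where K: "\<And>j \<theta>. \<theta> \<in> {0..1} \<Longrightarrow> norm (h (\<theta>, j)) \<le> K j"
    by metis
  have "integrable (?A \<Otimes>\<^sub>M ?B) h"
  proof (rule P.integrable_const_bound[where B = "max (K 0) (K 1)"])
    show "AE x in ?A \<Otimes>\<^sub>M ?B. norm (h x) \<le> max (K 0) (K 1)"
    proof (rule AE_I2)
      fix x assume "x \<in> space (?A \<Otimes>\<^sub>M ?B)"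
      then have "fst x \<in> {0..1}" by (auto simp: space_pair_measure space_restrict_space)
      from K[OF this, of "snd x"] show "norm (h x) \<le> max (K 0) (K 1)"
        using bit_cases[of "snd x"] by auto
    qed
  qed (rule meas)
  from P.integral_fst'[OF this]
  have "(\<integral>\<omega>. h \<omega> \<partial>circle_Z2) = (\<integral>\<theta>. (h (\<theta>, 0) + h (\<theta>, 1)) / 2 \<partial>?A)"
    by (simp add: circle_Z2_def integral_uniform_count_measure)
  also have "\<dots> = (LINT \<theta>:{0..<1}|lborel. (h (\<theta>, 0) + h (\<theta>, 1)) / 2)"
    by (simp add: integral_restrict_space set_lebesgue_integral_def)
  also have "\<dots> = integral {0..<1} (\<lambda>\<theta>. (h (\<theta>, 0) + h (\<theta>, 1)) / 2)"
  proof (rule set_borel_integral_eq_integral(2))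
    have "set_integrable lborel {0..1} (\<lambda>\<theta>. (h (\<theta>, 0) + h (\<theta>, 1)) / 2)"
      by (intro borel_integrable_atLeastAtMost' continuous_intros continuous_on_subset[OF cont]) auto
    then show "set_integrable lborel {0..<1} (\<lambda>\<theta>. (h (\<theta>, 0) + h (\<theta>, 1)) / 2)"
      by (rule set_integrable_subset) auto
  qed
  \<comment> \<open>Adding the endpoint 1 changes the domain by a null set.\<close>
  also have "\<dots> = integral {0..1} (\<lambda>\<theta>. (h (\<theta>, 0) + h (\<theta>, 1)) / 2)"
    by (rule integral_subset_negligible) (auto intro: negligible_subset[of "{1}"])
  also have "\<dots> = integral {0..1} (\<lambda>\<theta>. h (\<theta>, 0) + h (\<theta>, 1)) / 2"
    by simp
  also have "integral {0..1} (\<lambda>\<theta>. h (\<theta>, 0) + h (\<theta>, 1)) =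
      integral {0..1} (\<lambda>\<theta>. h (\<theta>, 0)) + integral {0..1} (\<lambda>\<theta>. h (\<theta>, 1))"
    by (intro Henstock_Kurzweil_Integration.integral_add integrable_continuous_real
        continuous_on_subset[OF cont]) auto
  finally show ?thesis .
qed

section \<open>Continuity, submultiplicativity and positivity of matrix norms\<close>

lemma continuous_on_onorm_matrix [continuous_intros]:
  fixes A :: "'a::topological_space \<Rightarrow> complex^'n^'m"
  assumes "continuous_on S A"
  shows "continuous_on S (\<lambda>x. onorm ((*v) (A x)))"
proof -
  \<comment> \<open>\<open>onorm\<close> becomes the norm of a \<open>Blinfun\<close>; the passage
    from matrices to these is linear on a finite-dimensional space, hence continuous.\<close>
  have "linear (\<lambda>M :: complex^'n^'m. Blinfun ((*v) M))"
    by (intro linearI blinfun_eqI)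
       (simp_all add: bounded_linear_Blinfun_apply matrix_vector_mult_add_rdistrib
         blinfun.bilinear_simps matrix_vector_mult_def vec_eq_iff scaleR_sum_right distrib_right sum.distrib)
  then have bl: "bounded_linear (\<lambda>M :: complex^'n^'m. Blinfun ((*v) M))"
    by (simp add: linear_conv_bounded_linear)
  have "continuous_on S (\<lambda>x. norm (Blinfun ((*v) (A x))))"
    by (rule continuous_on_norm[OF bounded_linear.continuous_on[OF bl assms]])
  then show ?thesis
    by (simp add: norm_blinfun.rep_eq bounded_linear_Blinfun_apply)
qed

lemma continuous_on_matrix_mult [continuous_intros]:
  fixes A :: "'a::topological_space \<Rightarrow> complex^'n^'m" and B :: "'a \<Rightarrow> complex^'k^'n"
  assumes "continuous_on S A" "continuous_on S B"
  shows "continuous_on S (\<lambda>x. A x ** B x)"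
  unfolding matrix_matrix_mult_def using assms by (intro continuous_intros)

lemma continuous_on_matrix_2I:
  fixes A :: "'a::topological_space \<Rightarrow> complex^2^2"
  assumes "\<And>i j. continuous_on S (\<lambda>x. A x $ i $ j)"
  shows "continuous_on S A"
proof -
  have "continuous_on S (\<lambda>x. \<chi> i j. A x $ i $ j)"
    by (intro continuous_intros assms)
  then show ?thesis by simp
qed

lemma continuous_on_szego_matrix:
  assumes "continuous_on S g" and "\<And>x. x \<in> S \<Longrightarrow> cmod (g x) < 1"
  shows "continuous_on S (\<lambda>x. szego_matrix z (g x))"
proof (rule continuous_on_matrix_2I)
  fix i j :: 2
  have "\<forall>x\<in>S. 1 - (cmod (g x))\<^sup>2 \<noteq> 0"
    using assms(2) by (fastforce simp: abs_square_eq_1)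
  then show "continuous_on S (\<lambda>x. szego_matrix z (g x) $ i $ j)"
    using exhaust_2[of i] exhaust_2[of j]
    by (elim disjE; simp only: szego_matrix_entries; intro continuous_intros assms(1)) auto
qed

lemma onorm_matrix_mult_le:
  fixes A :: "complex^'n^'m" and B :: "complex^'k^'n"
  shows "onorm ((*v) (A ** B)) \<le> onorm ((*v) A) * onorm ((*v) B)"
proof -
  have "(*v) (A ** B) = (*v) A \<circ> (*v) B"
    by (simp add: fun_eq_iff matrix_vector_mul_assoc)
  then show ?thesis by (simp add: onorm_compose)
qed

text \<open>An invertible matrix is not the zero map. This keeps the logarithms of cocycle norms
  away from the default value of \<open>ln\<close> at 0.\<close>

lemma onorm_matrix_pos:
  fixes A :: "complex^2^2"
  assumes "det A \<noteq> 0"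
  shows "0 < onorm ((*v) A)"
proof -
  have "(*v) A \<noteq> (\<lambda>x. 0)"
  proof
    assume "(*v) A = (\<lambda>x. 0)"
    then have "A *v x = 0 *v x" for x by simp
    then have "A = 0" by (simp add: matrix_eq)
    with assms show False by (simp add: det_2)
  qed
  then show ?thesis
    by (subst onorm_pos_lt) (auto simp: fun_eq_iff)
qed

section \<open>The cocycle identity, determinants, and the lift to the real line\<close>

lemma szego_cocycle_add:
  "szego_cocycle T f z (m + n) \<omega> =
    szego_cocycle T f z m ((T ^^ n) \<omega>) ** szego_cocycle T f z n \<omega>"
proof (induction m)
  case (Suc m)
  have "(T ^^ (m + n)) \<omega> = (T ^^ m) ((T ^^ n) \<omega>)"
    by (simp only: funpow_add o_apply)
  with Suc show ?case
    by (simp only: add_Suc szego_cocycle.simps matrix_mul_assoc)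
next
  case 0
  show ?case by (simp only: add_0 szego_cocycle.simps matrix_mul_lid)
qed

lemma det_szego_matrix_nonzero:
  assumes "cmod z = 1" "cmod a < 1"
  shows "det (szego_matrix z a) \<noteq> 0"
proof -
  define c where "c = (1 - (cmod a)\<^sup>2) powr (- 1 / 2)"
  have lt: "(cmod a)\<^sup>2 < 1"
    using assms by (simp add: power_less_one_iff abs_square_less_1)
  have "det (szego_matrix z a) = of_real (c\<^sup>2) * z * (1 - a * cnj a)"
    unfolding det_2 szego_matrix_entries c_def[symmetric]
    by (simp add: scaleR_conv_of_real power2_eq_square algebra_simps)
  also have "\<dots> = of_real (c\<^sup>2) * z * of_real (1 - (cmod a)\<^sup>2)"
    by (simp add: complex_norm_square[symmetric])
  also have "\<dots> \<noteq> 0"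
    using assms lt by (auto simp: c_def simp del: of_real_diff)
  finally show ?thesis .
qed

lemma det_szego_cocycle_nonzero:
  assumes "cmod z = 1" "\<And>x. cmod (f x) < 1"
  shows "det (szego_cocycle T f z n \<omega>) \<noteq> 0"
  by (induction n) (simp_all add: det_mul det_szego_matrix_nonzero assms)

text \<open>The shift without \<open>frac\<close>, on \<open>\<real> \<times> \<int>\<^sub>2\<close>: for periodic \<open>f\<close> the cocycle is unchanged, but now
  depends continuously on \<open>\<theta>\<close>.\<close>

definition lifted_shift :: "real \<Rightarrow> real \<times> bit \<Rightarrow> real \<times> bit" where
  "lifted_shift \<alpha> = (\<lambda>(\<theta>, j). (\<theta> + \<alpha>, j + 1))"

lemma funpow_lifted_shift: "(lifted_shift \<alpha> ^^ n) (\<theta>, j) = (\<theta> + real n * \<alpha>, j + of_nat n)"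
proof (induction n)
  case (Suc n)
  have "(lifted_shift \<alpha> ^^ Suc n) (\<theta>, j) = lifted_shift \<alpha> (\<theta> + real n * \<alpha>, j + of_nat n)"
    by (simp only: funpow.simps o_apply Suc.IH)
  also have "\<dots> = (\<theta> + real (Suc n) * \<alpha>, j + of_nat (Suc n))"
    by (simp only: lifted_shift_def prod.case of_nat_Suc prod.inject ac_simps) (simp add: distrib_left)
  finally show ?case .
next
  case 0
  show ?case by simp
qed

text \<open>The first coordinate is described only through its fractional part because
  \<open>frac\<close> acts from the first step on: for \<open>n = 0\<close> it is \<theta> itself,
  which may lie outside the fundamental domain.\<close>

lemma funpow_circle_Z2_shift:
  "\<exists>t. (circle_Z2_shift \<alpha> ^^ n) (\<theta>, j) = (t, j + of_nat n) \<and> frac t = frac (\<theta> + real n * \<alpha>)"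
proof (induction n)
  case (Suc n)
  then obtain t where t: "(circle_Z2_shift \<alpha> ^^ n) (\<theta>, j) = (t, j + of_nat n)"
    "frac t = frac (\<theta> + real n * \<alpha>)" by blast
  have "frac (t + \<alpha>) = frac (\<theta> + real n * \<alpha> + \<alpha>)"
    by (metis frac_add_simps(1) t(2))
  then have "frac (frac (t + \<alpha>)) = frac (\<theta> + real (Suc n) * \<alpha>)"
    by (simp add: algebra_simps)
  moreover have "(circle_Z2_shift \<alpha> ^^ Suc n) (\<theta>, j) = circle_Z2_shift \<alpha> (t, j + of_nat n)"
    by (simp only: funpow.simps o_apply t(1))
  then have "(circle_Z2_shift \<alpha> ^^ Suc n) (\<theta>, j) = (frac (t + \<alpha>), j + of_nat (Suc n))"
    by (simp only: circle_Z2_shift_def prod.case of_nat_Suc ac_simps)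
  ultimately show ?case by blast
next
  case 0
  show ?case by simp
qed

text \<open>\<open>f\<close> lives on the whole real line in its first variable:
  \<open>f_frac\<close> expresses 1-periodicity, and together with \<open>cont_f\<close> it gives
  continuity across the point where the ends of the fundamental domain are glued.\<close>

locale szego_rotation =
  fixes \<alpha> :: real and f :: "real \<times> bit \<Rightarrow> complex" and z :: complex
  assumes cont_f: "continuous_on UNIV (\<lambda>\<theta>. f (\<theta>, j))"
    and f_frac: "f (frac \<theta>, j) = f (\<theta>, j)"
    and f_disk: "cmod (f x) < 1"
    and norm_z: "cmod z = 1"
begin

abbreviation "A n \<theta> j \<equiv> szego_cocycle (lifted_shift \<alpha>) f z n (\<theta>, j)"
abbreviation "N n \<theta> j \<equiv> onorm ((*v) (A n \<theta> j))"
abbreviation "c x \<equiv> (1 - (cmod (f x))\<^sup>2) powr (- 1 / 2)"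

lemma szego_cocycle_lift:
  "szego_cocycle (circle_Z2_shift \<alpha>) f z n (\<theta>, j) = A n \<theta> j"
proof (induction n)
  case (Suc n)
  obtain t where t: "(circle_Z2_shift \<alpha> ^^ n) (\<theta>, j) = (t, j + of_nat n)"
    "frac t = frac (\<theta> + real n * \<alpha>)"
    using funpow_circle_Z2_shift by blast
  have "f (t, j + of_nat n) = f (\<theta> + real n * \<alpha>, j + of_nat n)"
    by (metis f_frac t(2))
  with Suc t show ?case by (simp add: funpow_lifted_shift)
qed simp

lemma A_Suc: "A (Suc n) \<theta> j = szego_matrix z (f (\<theta> + real n * \<alpha>, j + of_nat n)) ** A n \<theta> j"
  by (simp add: funpow_lifted_shift)

declare szego_cocycle.simps(2) [simp del]

lemma A_periodic: "A n (\<theta> + 1) j = A n \<theta> j"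
proof (induction n)
  case (Suc n)
  have "f (x + 1, i) = f (x, i)" for x i
    by (metis f_frac frac_1_eq)
  from this[of "\<theta> + real n * \<alpha>"] Suc show ?case
    by (simp add: A_Suc algebra_simps)
qed simp

lemma continuous_A: "continuous_on UNIV (\<lambda>\<theta>. A n \<theta> j)"
proof (induction n)
  case (Suc n)
  have f: "continuous_on UNIV (\<lambda>\<theta>. f (\<theta> + real n * \<alpha>, j + of_nat n))"
    by (rule continuous_on_compose2[OF cont_f]) (auto intro!: continuous_intros)
  with Suc show ?case
    unfolding A_Suc by (intro continuous_intros continuous_on_szego_matrix f_disk)
qed simp

lemma N_pos: "0 < N n \<theta> j"
  by (intro onorm_matrix_pos det_szego_cocycle_nonzero norm_z f_disk)

lemma continuous_N: "continuous_on S (\<lambda>\<theta>. N n \<theta> j)"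
  by (rule continuous_on_subset[OF continuous_on_onorm_matrix[OF continuous_A]]) simp

lemma continuous_ln_N: "continuous_on S (\<lambda>\<theta>. ln (N n \<theta> j))"
proof -
  have "N n \<theta> j \<noteq> 0" for \<theta>
    using N_pos[of n \<theta> j] by linarith
  then show ?thesis
    by (intro continuous_on_ln continuous_N) blast
qed

text \<open>The integral in the definition of the Lyapunov exponent, as an average over the two
  sheets and for the lifted cocycle, whose continuity makes all these integrals exist.\<close>

definition L :: "nat \<Rightarrow> real" where
  "L n = (integral {0..1} (\<lambda>\<theta>. ln (N n \<theta> 0)) + integral {0..1} (\<lambda>\<theta>. ln (N n \<theta> 1))) / 2"

lemma integral_ln_norm_cocycle:
  "(\<integral>\<omega>. ln (onorm ((*v) (szego_cocycle (circle_Z2_shift \<alpha>) f z n \<omega>))) \<partial>circle_Z2) = L n"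
proof -
  have "continuous_on UNIV
      (\<lambda>\<theta>. ln (onorm ((*v) (szego_cocycle (circle_Z2_shift \<alpha>) f z n (\<theta>, j)))))" for j
    unfolding szego_cocycle_lift by (rule continuous_ln_N)
  from integral_circle_Z2[where h =
      "\<lambda>\<omega>. ln (onorm ((*v) (szego_cocycle (circle_Z2_shift \<alpha>) f z n \<omega>)))", OF this]
  show ?thesis
    unfolding L_def szego_cocycle_lift .
qed

text \<open>The cocycle identity and submultiplicativity of the operator norm bound the integrand by
  two terms, one of them evaluated at a shifted point. The translation of \<theta> does not change
  the integral by periodicity, and the shift of \<open>j\<close> disappears in the average over both
  sheets.\<close>

lemma L_subadditive: "L (m + n) \<le> L m + L n"
proof -
  have int: "(\<lambda>\<theta>. ln (N m (\<theta> + t) j)) integrable_on {0..1}" for m t j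
  proof (rule integrable_continuous_real)
    have "continuous_on {0..1} (\<lambda>\<theta>. \<theta> + t)" by (intro continuous_intros)
    from continuous_on_compose2[OF continuous_ln_N[of UNIV] this]
    show "continuous_on {0..1} (\<lambda>\<theta>. ln (N m (\<theta> + t) j))" by simp
  qed
  have int0: "(\<lambda>\<theta>. ln (N m \<theta> j)) integrable_on {0..1}" for m j
    using int[of m 0 j] by simp
  have le: "integral {0..1} (\<lambda>\<theta>. ln (N (m + n) \<theta> j)) \<le>
      integral {0..1} (\<lambda>\<theta>. ln (N m \<theta> (j + of_nat n))) + integral {0..1} (\<lambda>\<theta>. ln (N n \<theta> j))" for j
  proof -
    note ints = int[of m "real n * \<alpha>" "j + of_nat n"] int0[of n j]
    have "integral {0..1} (\<lambda>\<theta>. ln (N (m + n) \<theta> j)) \<le>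
        integral {0..1} (\<lambda>\<theta>. ln (N m (\<theta> + real n * \<alpha>) (j + of_nat n)) + ln (N n \<theta> j))"
    proof (rule integral_le[OF int0[of "m + n" j] Henstock_Kurzweil_Integration.integrable_add[OF ints]])
      fix \<theta> :: real
      have "N (m + n) \<theta> j \<le> N m (\<theta> + real n * \<alpha>) (j + of_nat n) * N n \<theta> j"
        unfolding szego_cocycle_add funpow_lifted_shift by (rule onorm_matrix_mult_le)
      then have "ln (N (m + n) \<theta> j) \<le> ln (N m (\<theta> + real n * \<alpha>) (j + of_nat n) * N n \<theta> j)"
        using N_pos by (subst ln_le_cancel_iff) auto
      also have "\<dots> = ln (N m (\<theta> + real n * \<alpha>) (j + of_nat n)) + ln (N n \<theta> j)"
        using N_pos by (intro ln_mult_pos) auto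
      finally show "ln (N (m + n) \<theta> j) \<le>
          ln (N m (\<theta> + real n * \<alpha>) (j + of_nat n)) + ln (N n \<theta> j)" .
    qed
    also have "\<dots> = integral {0..1} (\<lambda>\<theta>. ln (N m (\<theta> + real n * \<alpha>) (j + of_nat n))) +
        integral {0..1} (\<lambda>\<theta>. ln (N n \<theta> j))"
      by (rule Henstock_Kurzweil_Integration.integral_add[OF ints])
    also have "integral {0..1} (\<lambda>\<theta>. ln (N m (\<theta> + real n * \<alpha>) (j + of_nat n))) =
        integral {0..1} (\<lambda>\<theta>. ln (N m \<theta> (j + of_nat n)))"
      by (rule integral_periodic_shift[where g = "\<lambda>\<theta>. ln (N m \<theta> (j + of_nat n))"])
         (rule continuous_ln_N, simp only: A_periodic)
    finally show ?thesis .
  qed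
  \<comment> \<open>An even \<open>n\<close> fixes the two sheets and an odd \<open>n\<close>
    exchanges them.\<close>
  have "integral {0..1} (\<lambda>\<theta>. ln (N m \<theta> (0 + of_nat n))) +
      integral {0..1} (\<lambda>\<theta>. ln (N m \<theta> (1 + of_nat n))) =
      integral {0..1} (\<lambda>\<theta>. ln (N m \<theta> 0)) + integral {0..1} (\<lambda>\<theta>. ln (N m \<theta> 1))"
  proof (cases "of_nat n = (0 :: bit)")
    case True
    show ?thesis unfolding True by (simp only: add_0_right)
  next
    case False
    then have "of_nat n = (1 :: bit)" using bit_cases by blast
    then show ?thesis by (simp only: add_0 add_0_right bit_1_plus_1 add.commute)
  qed
  then show ?thesis
    using le[of 0] le[of 1] unfolding L_def by argo
qed

end

subsection \<open>Polynomial form of the cocycle\<close>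

lemma szego_matrix_vector:
  "(szego_matrix z a *v x) $ 1 =
    of_real ((1 - (cmod a)\<^sup>2) powr (- 1 / 2)) * (z * x $ 1 - cnj a * x $ 2)"
  "(szego_matrix z a *v x) $ 2 =
    of_real ((1 - (cmod a)\<^sup>2) powr (- 1 / 2)) * (x $ 2 - a * z * x $ 1)"
  unfolding matrix_vector_mult_def vec_lambda_beta sum_2 szego_matrix_entries scaleR_conv_of_real
  by (simp_all add: algebra_simps)

text \<open>Conjugation destroys holomorphy, but on the unit circle the conjugate of
  \<open>f\<close> times \<open>w ^ k\<close> again agrees with a polynomial. Hence
  \<open>Bs\<close> is a second family beside \<open>B\<close>, and the two are evaluated at the
  origin separately.\<close>

locale szego_rotation_poly = szego_rotation +
  fixes k :: int and B Bs :: "bit \<Rightarrow> complex poly" and r :: real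
  assumes k_pos: "1 \<le> k" and r_pos: "0 < r"
    and f_poly: "fourier_char k \<theta> * f (\<theta>, j) = poly (B j) (fourier_char 1 \<theta>)"
    and cnj_f_poly: "fourier_char k \<theta> * cnj (f (\<theta>, j)) = poly (Bs j) (fourier_char 1 \<theta>)"
    and norm_Bs: "cmod (poly (Bs 0) 0) = r"
    and norm_B: "cmod (poly (B 1) 0) = r"
begin

text \<open>At \<open>w = 0\<close> one step of the polynomial cocycle is \<open>(p, q) \<mapsto> (- Bs(0) q, - z B(0) p)\<close>. The starting
  vector is chosen such that it only ever meets the values \<open>Bs 0\<close> and \<open>B 1\<close>, which have modulus \<open>r\<close>.\<close>

lemma cocycle_vector_poly:
  "\<exists>p q. (\<forall>\<theta>.
      (\<Prod>i<n. fourier_char k (\<theta> + real i * \<alpha>)) * (A n \<theta> j *v axis (if j = 0 then 2 else 1) 1) $ 1 =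
        of_real (\<Prod>i<n. c (\<theta> + real i * \<alpha>, j + of_nat i)) * poly p (fourier_char 1 \<theta>) \<and>
      (\<Prod>i<n. fourier_char k (\<theta> + real i * \<alpha>)) * (A n \<theta> j *v axis (if j = 0 then 2 else 1) 1) $ 2 =
        of_real (\<Prod>i<n. c (\<theta> + real i * \<alpha>, j + of_nat i)) * poly q (fourier_char 1 \<theta>)) \<and>
    (if j + of_nat n = 0 then poly p 0 = 0 \<and> cmod (poly q 0) = r ^ n
     else cmod (poly p 0) = r ^ n \<and> poly q 0 = 0)"
proof (induction n)
  case 0
  show ?case
    by (rule exI[of _ "if j = 0 then 0 else 1"], rule exI[of _ "if j = 0 then 1 else 0"])
       (simp add: axis_def)
next
  case (Suc n)
  define e where "e = (axis (if j = 0 then 2 else 1) 1 :: complex^2)"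
  define W where "W \<theta> = (\<Prod>i<n. fourier_char k (\<theta> + real i * \<alpha>))" for \<theta>
  define C where "C \<theta> = (\<Prod>i<n. c (\<theta> + real i * \<alpha>, j + of_nat i))" for \<theta>
  define b where "b = j + of_nat n"
  obtain p q where
    p: "\<And>\<theta>. W \<theta> * (A n \<theta> j *v e) $ 1 = of_real (C \<theta>) * poly p (fourier_char 1 \<theta>)" and
    q: "\<And>\<theta>. W \<theta> * (A n \<theta> j *v e) $ 2 = of_real (C \<theta>) * poly q (fourier_char 1 \<theta>)" and
    pq: "if b = 0 then poly p 0 = 0 \<and> cmod (poly q 0) = r ^ n
      else cmod (poly p 0) = r ^ n \<and> poly q 0 = 0"
    using Suc.IH unfolding e_def[symmetric] W_def[symmetric] C_def[symmetric] b_def[symmetric] by blast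
  \<comment> \<open>The rotation by \<open>n\<close> steps is the substitution of \<open>Y\<close>
    for \<open>w\<close>, a linear polynomial that fixes the origin.\<close>
  define Y where "Y = [:0, fourier_char 1 (real n * \<alpha>):]"
  \<comment> \<open>\<open>p'\<close> and \<open>q'\<close> are the coordinates after one more step
    of the unnormalized matrix multiplied by the \<open>k\<close>-th power of the rotated
    variable.\<close>
  define p' where "p' = smult z (Y ^ nat k) * p - pcompose (Bs b) Y * q"
  define q' where "q' = Y ^ nat k * q - smult z (pcompose (B b) Y) * p"
  have Y: "poly Y (fourier_char 1 \<theta>) = fourier_char 1 (\<theta> + real n * \<alpha>)" for \<theta>
    by (simp add: Y_def fourier_char_add)
  have Yk: "poly (Y ^ nat k) (fourier_char 1 \<theta>) = fourier_char k (\<theta> + real n * \<alpha>)" for \<theta>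
    using k_pos by (simp add: poly_power Y fourier_char_nat[of k])
  have step: "A (Suc n) \<theta> j *v e = szego_matrix z (f (\<theta> + real n * \<alpha>, b)) *v (A n \<theta> j *v e)" for \<theta>
    by (simp only: A_Suc b_def matrix_vector_mul_assoc)
  have p'_eq: "W \<theta> * fourier_char k (\<theta> + real n * \<alpha>) * (A (Suc n) \<theta> j *v e) $ 1 =
      of_real (C \<theta> * c (\<theta> + real n * \<alpha>, b)) * poly p' (fourier_char 1 \<theta>)" for \<theta>
  proof -
    define t where "t = \<theta> + real n * \<alpha>"
    have "W \<theta> * fourier_char k t * (A (Suc n) \<theta> j *v e) $ 1 = of_real (c (t, b)) *
        (z * fourier_char k t * (W \<theta> * (A n \<theta> j *v e) $ 1) -
         (fourier_char k t * cnj (f (t, b))) * (W \<theta> * (A n \<theta> j *v e) $ 2))"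
      unfolding step szego_matrix_vector t_def[symmetric] by (simp only: algebra_simps)
    also have "\<dots> = of_real (C \<theta> * c (t, b)) * poly p' (fourier_char 1 \<theta>)"
      unfolding p q cnj_f_poly p'_def poly_diff poly_mult poly_smult Yk poly_pcompose Y t_def
        of_real_mult
      by (simp only: algebra_simps)
    finally show ?thesis unfolding t_def .
  qed
  have q'_eq: "W \<theta> * fourier_char k (\<theta> + real n * \<alpha>) * (A (Suc n) \<theta> j *v e) $ 2 =
      of_real (C \<theta> * c (\<theta> + real n * \<alpha>, b)) * poly q' (fourier_char 1 \<theta>)" for \<theta>
  proof -
    define t where "t = \<theta> + real n * \<alpha>"
    have "W \<theta> * fourier_char k t * (A (Suc n) \<theta> j *v e) $ 2 = of_real (c (t, b)) *
        (fourier_char k t * (W \<theta> * (A n \<theta> j *v e) $ 2) -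
         z * (fourier_char k t * f (t, b)) * (W \<theta> * (A n \<theta> j *v e) $ 1))"
      unfolding step szego_matrix_vector t_def[symmetric] by (simp only: algebra_simps)
    also have "\<dots> = of_real (C \<theta> * c (t, b)) * poly q' (fourier_char 1 \<theta>)"
      unfolding p q f_poly q'_def poly_diff poly_mult poly_smult Yk poly_pcompose Y t_def
        of_real_mult
      by (simp only: algebra_simps)
    finally show ?thesis unfolding t_def .
  qed
  \<comment> \<open>Since \<open>k\<close> is positive, the diagonal of the polynomial matrix
    vanishes at the origin and only the antidiagonal survives.\<close>
  have "poly (Y ^ nat k) 0 = 0" "poly Y 0 = 0"
    using k_pos by (simp_all add: Y_def poly_power)
  then have zero: "poly p' 0 = - (poly (Bs b) 0 * poly q 0)" "poly q' 0 = - (z * poly (B b) 0 * poly p 0)"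
    by (simp_all add: p'_def q'_def poly_pcompose)
  have "j + of_nat (Suc n) = b + 1"
    by (simp only: b_def of_nat_Suc ac_simps)
  \<comment> \<open>From sheet 0 the nonzero value moves from \<open>q\<close> to \<open>p\<close>
    with factor \<open>Bs 0\<close>; from sheet 1 it moves back with factor \<open>z\<close> times
    \<open>B 1\<close>.\<close>
  moreover have "if b + 1 = 0 then poly p' 0 = 0 \<and> cmod (poly q' 0) = r ^ Suc n
      else cmod (poly p' 0) = r ^ Suc n \<and> poly q' 0 = 0"
    using bit_cases[of b] pq by (elim disjE) (auto simp: zero norm_mult norm_B norm_Bs norm_z)
  ultimately show ?case
    unfolding e_def[symmetric] prod.lessThan_Suc W_def[symmetric] C_def[symmetric] b_def[symmetric]
    using p'_eq q'_eq by metis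
qed

text \<open>A coordinate of the image of a unit vector is bounded by the operator norm. The product
  of characters has modulus 1, and each normalizing factor is at least
  \<open>1 / sqrt D\<close>.\<close>

lemma poly_le_N:
  assumes D: "\<And>x. 1 - (cmod (f x))\<^sup>2 \<le> D"
  shows "\<exists>p. cmod (poly p 0) = r ^ n \<and>
    (\<forall>\<theta>. cmod (poly p (fourier_char 1 \<theta>)) \<le> N n \<theta> j * sqrt D ^ n)"
proof -
  define e where "e = (axis (if j = 0 then 2 else 1) 1 :: complex^2)"
  define W where "W \<theta> = (\<Prod>i<n. fourier_char k (\<theta> + real i * \<alpha>))" for \<theta>
  define C where "C \<theta> = (\<Prod>i<n. c (\<theta> + real i * \<alpha>, j + of_nat i))" for \<theta>
  \<comment> \<open>\<open>s\<close> is the coordinate that survives at the origin, decided by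
    \<open>j + of_nat n\<close>.\<close>
  have "\<exists>p s. cmod (poly p 0) = r ^ n \<and>
      (\<forall>\<theta>. W \<theta> * (A n \<theta> j *v e) $ s = of_real (C \<theta>) * poly p (fourier_char 1 \<theta>))"
    using cocycle_vector_poly[of n j] unfolding e_def[symmetric] W_def[symmetric] C_def[symmetric]
    by meson
  then obtain p s where p0: "cmod (poly p 0) = r ^ n" and
    p: "\<And>\<theta>. W \<theta> * (A n \<theta> j *v e) $ s = of_real (C \<theta>) * poly p (fourier_char 1 \<theta>)"
    by blast
  have pos: "0 < 1 - (cmod (f x))\<^sup>2" for x
    using f_disk[of x] by (simp add: abs_square_less_1)
  \<comment> \<open>Evaluation at an arbitrary point suffices, as the values of \<open>f\<close> lie
    in the open disk.\<close>
  have D0: "0 < D" using D[of undefined] pos[of undefined] by linarith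
  have "cmod (poly p (fourier_char 1 \<theta>)) \<le> N n \<theta> j * sqrt D ^ n" for \<theta>
  proof -
    have "1 / sqrt D \<le> c x" for x
    proof -
      have "1 / sqrt D = D powr (- 1 / 2)"
        using D0 by (simp add: powr_minus_divide powr_half_sqrt)
      also have "\<dots> \<le> c x"
        using D[of x] pos[of x] by (intro powr_mono2') auto
      finally show ?thesis .
    qed
    then have "(\<Prod>i<n. 1 / sqrt D) \<le> C \<theta>"
      unfolding C_def using D0 by (intro prod_mono) auto
    then have C: "1 / sqrt D ^ n \<le> C \<theta>"
      by (simp add: power_divide)
    have "cmod (W \<theta>) = 1"
      by (simp add: W_def prod_norm[symmetric])
    then have "C \<theta> * cmod (poly p (fourier_char 1 \<theta>)) = cmod ((A n \<theta> j *v e) $ s)"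
      using arg_cong[OF p[of \<theta>], of cmod] C D0
      by (simp add: norm_mult) (smt (verit) zero_le_divide_1_iff real_sqrt_ge_zero zero_le_power)
    also have "\<dots> \<le> norm (A n \<theta> j *v e)"
      by (rule Finite_Cartesian_Product.norm_nth_le)
    also have "\<dots> \<le> N n \<theta> j * norm e"
      by (rule onorm[OF matrix_vector_mul_bounded_linear])
    also have "norm e = 1" by (simp add: e_def)
    finally have "C \<theta> * cmod (poly p (fourier_char 1 \<theta>)) \<le> N n \<theta> j" by simp
    moreover have "1 / sqrt D ^ n * cmod (poly p (fourier_char 1 \<theta>)) \<le>
        C \<theta> * cmod (poly p (fourier_char 1 \<theta>))"
      by (intro mult_right_mono C) simp
    ultimately have "1 / sqrt D ^ n * cmod (poly p (fourier_char 1 \<theta>)) \<le> N n \<theta> j" by linarith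
    then show ?thesis using D0 by (simp add: field_simps)
  qed
  with p0 show ?thesis by blast
qed

text \<open>Jensen's inequality applied on each sheet to the polynomial of \<open>poly_le_N\<close>:
  its value at the origin has logarithm \<open>n * ln r\<close>, and the factor
  \<open>sqrt D ^ n\<close> is moved to the other side.\<close>

lemma L_ge:
  assumes D: "\<And>x. 1 - (cmod (f x))\<^sup>2 \<le> D"
  shows "(ln r - ln (sqrt D)) * real n \<le> L n"
proof -
  have D0: "0 < sqrt D"
    using D[of undefined] f_disk[of undefined] abs_square_less_1[of "cmod (f undefined)"] by simp
  have "(ln r - ln (sqrt D)) * real n \<le> integral {0..1} (\<lambda>\<theta>. ln (N n \<theta> j))" for j
  proof -
    obtain p where p0: "cmod (poly p 0) = r ^ n" and
      p: "\<And>\<theta>. cmod (poly p (fourier_char 1 \<theta>)) \<le> N n \<theta> j * sqrt D ^ n"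
      using poly_le_N[OF D] by blast
    have "ln (cmod (poly p 0)) \<le> integral {0..1} (\<lambda>\<theta>. ln (N n \<theta> j * sqrt D ^ n))"
    proof (rule jensen_poly_majorant)
      show "poly p 0 \<noteq> 0" using p0 r_pos by auto
      show "continuous_on {0..1} (\<lambda>\<theta>. N n \<theta> j * sqrt D ^ n)"
        by (rule continuous_on_mult_right[OF continuous_N])
      show "0 < N n \<theta> j * sqrt D ^ n" for \<theta>
        using D0 by (intro mult_pos_pos N_pos zero_less_power)
    qed (rule p)
    also have "(\<lambda>\<theta>. ln (N n \<theta> j * sqrt D ^ n)) = (\<lambda>\<theta>. ln (N n \<theta> j) + real n * ln (sqrt D))"
    proof
      fix \<theta>
      show "ln (N n \<theta> j * sqrt D ^ n) = ln (N n \<theta> j) + real n * ln (sqrt D)"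
        using ln_mult_pos[OF N_pos, of "sqrt D ^ n" n \<theta> j] D0 by (simp only: ln_realpow zero_less_power)
    qed
    also have "integral {0..1} \<dots> = integral {0..1} (\<lambda>\<theta>. ln (N n \<theta> j)) + real n * ln (sqrt D)"
      using Henstock_Kurzweil_Integration.integral_add[OF
          integrable_continuous_real[OF continuous_ln_N[of "{0..1}" n j]]
          integrable_continuous_real[OF continuous_on_const[of "{0..1}" "real n * ln (sqrt D)"]]]
      by simp
    finally show ?thesis
      using r_pos by (simp add: p0 ln_realpow algebra_simps)
  qed
  from this[of 0] this[of 1] show ?thesis
    unfolding L_def by argo
qed

text \<open>The linear lower bound on \<open>L\<close> serves twice: it makes Fekete's lemma
  applicable, so that \<open>lim\<close> denotes an actual limit, and it then passes to that
  limit.\<close>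

lemma lyapunov_exponent_ge:
  assumes D: "\<And>x. 1 - (cmod (f x))\<^sup>2 \<le> D"
  shows "ln r - ln (sqrt D) \<le> lyapunov_exponent circle_Z2 (circle_Z2_shift \<alpha>) f z"
proof -
  have "convergent (\<lambda>n. L n / real n)"
    by (rule subadditive_convergent[OF L_subadditive L_ge[OF D]])
  then have lim: "(\<lambda>n. L n / real n) \<longlonglongrightarrow> lim (\<lambda>n. L n / real n)"
    by (simp add: convergent_LIMSEQ_iff)
  have "ln r - ln (sqrt D) \<le> L n / real n" if "1 \<le> n" for n
    using L_ge[OF D, of n] that by (simp add: field_simps)
  then have "ln r - ln (sqrt D) \<le> lim (\<lambda>n. L n / real n)"
    by (intro LIMSEQ_le_const[OF lim]) blast
  then show ?thesis
    unfolding lyapunov_exponent_def integral_ln_norm_cocycle by simp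
qed

end

section \<open>The sampling function in polynomial form\<close>

context
  fixes k :: int
begin

text \<open>Multiplication by \<open>w ^ k\<close> shifts the exponents from \<open>- k..k\<close>
  to \<open>0..2 * k\<close>. For positive \<open>k\<close> the constant coefficient is
  \<open>c * a (- k)\<close>, which depends on the perturbation, whereas that of
  \<open>lo_poly\<close> does not.\<close>

definition hi_poly :: "complex \<Rightarrow> (int \<Rightarrow> complex) \<Rightarrow> complex poly" where
  "hi_poly c a = [:0, 1:] ^ nat (2 * k) + smult c (\<Sum>l = -k..k - 1. smult (a l) ([:0, 1:] ^ nat (k + l)))"

definition lo_poly :: "complex \<Rightarrow> (int \<Rightarrow> complex) \<Rightarrow> complex poly" where
  "lo_poly c a = 1 + smult c (\<Sum>l = -k..k - 1. smult (a l) ([:0, 1:] ^ nat (k - l)))"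

lemma poly_hi_poly:
  assumes "1 \<le> k"
  shows "poly (hi_poly c a) (fourier_char 1 \<theta>) =
    fourier_char k \<theta> * (fourier_char k \<theta> + c * (\<Sum>l = -k..k - 1. a l * fourier_char l \<theta>))"
proof -
  have "(\<Sum>l = -k..k - 1. a l * fourier_char 1 \<theta> ^ nat (k + l)) =
      fourier_char k \<theta> * (\<Sum>l = -k..k - 1. a l * fourier_char l \<theta>)"
    unfolding sum_distrib_left
    by (rule sum.cong) (simp_all add: fourier_char_nat[of "k + _", symmetric] fourier_char_mult[symmetric])
  moreover have "fourier_char 1 \<theta> ^ nat (2 * k) = fourier_char k \<theta> * fourier_char k \<theta>"
    using assms fourier_char_nat[of "2 * k" \<theta>] fourier_char_mult[of k \<theta> k] by simp
  ultimately show ?thesis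
    by (simp add: hi_poly_def poly_sum poly_power distrib_left)
qed

lemma poly_lo_poly:
  "poly (lo_poly c a) (fourier_char 1 \<theta>) =
    fourier_char k \<theta> * (fourier_char (- k) \<theta> + c * (\<Sum>l = -k..k - 1. a l * fourier_char (- l) \<theta>))"
proof -
  have "(\<Sum>l = -k..k - 1. a l * fourier_char 1 \<theta> ^ nat (k - l)) =
      fourier_char k \<theta> * (\<Sum>l = -k..k - 1. a l * fourier_char (- l) \<theta>)"
    unfolding sum_distrib_left
    by (rule sum.cong)
       (simp_all add: fourier_char_nat[of "k - _", symmetric] fourier_char_mult[of k _ "- _", simplified, symmetric])
  moreover have "fourier_char k \<theta> * fourier_char (- k) \<theta> = 1"
    using fourier_char_mult[of k \<theta> "- k"] by (simp add: fourier_char_def)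
  ultimately show ?thesis
    by (simp add: lo_poly_def poly_sum poly_power distrib_left)
qed

text \<open>The sum stops at \<open>k - 1\<close>, so every exponent \<open>k - l\<close> is at
  least 1 and the perturbation vanishes at the origin.\<close>

lemma poly_lo_poly_0: "poly (lo_poly c a) 0 = 1"
  by (simp add: lo_poly_def poly_sum poly_power zero_power)

end

text \<open>Conjugation turns the expression of one sheet into that of the other, with conjugated
  coefficients; this is why \<open>hi_poly\<close> and \<open>lo_poly\<close> change places between
  \<open>B\<close> and \<open>Bs\<close>.\<close>

lemma cnj_sampling_fun:
  "cnj (sampling_fun \<epsilon> k a c (\<theta>, j)) =
    of_real (sqrt (1 - \<epsilon>\<^sup>2)) *
      (if j = 0 then fourier_char (- k) \<theta> + cnj c * (\<Sum>l = -k..k - 1. cnj (a l) * fourier_char (- l) \<theta>)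
       else fourier_char k \<theta> + cnj c * (\<Sum>l = -k..k - 1. cnj (a l) * fourier_char l \<theta>))"
  by (simp add: sampling_fun_def cnj_fourier_char cnj_sum)

lemma norm_sampling_fun_bounds:
  assumes "\<epsilon>\<^sup>2 \<le> 1"
  shows "cmod (sampling_fun \<epsilon> k a c x) \<le> sqrt (1 - \<epsilon>\<^sup>2) * (1 + cmod c * (\<Sum>l = -k..k - 1. cmod (a l)))"
    and "sqrt (1 - \<epsilon>\<^sup>2) * (1 - cmod c * (\<Sum>l = -k..k - 1. cmod (a l))) \<le> cmod (sampling_fun \<epsilon> k a c x)"
proof -
  obtain \<theta> j where x: "x = (\<theta>, j)" by fastforce
  \<comment> \<open>The sign \<open>s\<close> treats both sheets at once: on sheet 1 all frequencies
    are reversed.\<close>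
  define s where "s = (if j = 0 then 1 else - 1 :: int)"
  define y where "y = c * (\<Sum>l = -k..k - 1. a l * fourier_char (s * l) \<theta>)"
  have "cmod (\<Sum>l = -k..k - 1. a l * fourier_char (s * l) \<theta>) \<le> (\<Sum>l = -k..k - 1. cmod (a l))"
    by (rule sum_norm_le) (simp add: norm_mult)
  then have y: "cmod y \<le> cmod c * (\<Sum>l = -k..k - 1. cmod (a l))"
    by (simp add: y_def norm_mult mult_left_mono)
  have "sampling_fun \<epsilon> k a c x = of_real (sqrt (1 - \<epsilon>\<^sup>2)) * (fourier_char (s * k) \<theta> + y)"
    by (simp add: sampling_fun_def x y_def s_def)
  then have eq: "cmod (sampling_fun \<epsilon> k a c x) = sqrt (1 - \<epsilon>\<^sup>2) * cmod (fourier_char (s * k) \<theta> + y)"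
    using assms by (simp add: norm_mult)
  have "cmod (fourier_char (s * k) \<theta> + y) \<le> 1 + cmod c * (\<Sum>l = -k..k - 1. cmod (a l))"
    using norm_triangle_ineq[of "fourier_char (s * k) \<theta>" y] y by simp
  then show "cmod (sampling_fun \<epsilon> k a c x) \<le> sqrt (1 - \<epsilon>\<^sup>2) * (1 + cmod c * (\<Sum>l = -k..k - 1. cmod (a l)))"
    unfolding eq using assms by (intro mult_left_mono) auto
  have "1 - cmod c * (\<Sum>l = -k..k - 1. cmod (a l)) \<le> cmod (fourier_char (s * k) \<theta> + y)"
    using norm_diff_ineq[of "fourier_char (s * k) \<theta>" y] y by simp
  then show "sqrt (1 - \<epsilon>\<^sup>2) * (1 - cmod c * (\<Sum>l = -k..k - 1. cmod (a l))) \<le> cmod (sampling_fun \<epsilon> k a c x)"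
    unfolding eq using assms by (intro mult_left_mono) auto
qed

text \<open>The two prescribed moduli belong to \<open>Bs 0\<close> and \<open>B 1\<close>, both
  built from \<open>lo_poly\<close>. Its value 1 at the origin makes them equal to
  \<open>sqrt (1 - \<epsilon>\<^sup>2)\<close> for every \<open>c\<close>.\<close>

lemma szego_rotation_poly_sampling_fun:
  assumes "\<epsilon>\<^sup>2 < 1" "1 \<le> k" "cmod z = 1" and disk: "\<And>x. cmod (sampling_fun \<epsilon> k a c x) < 1"
  shows "szego_rotation_poly (sampling_fun \<epsilon> k a c) z k
    (\<lambda>j. smult (of_real (sqrt (1 - \<epsilon>\<^sup>2))) (if j = 0 then hi_poly k c a else lo_poly k c a))
    (\<lambda>j. smult (of_real (sqrt (1 - \<epsilon>\<^sup>2)))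
      (if j = 0 then lo_poly k (cnj c) (cnj \<circ> a) else hi_poly k (cnj c) (cnj \<circ> a)))
    (sqrt (1 - \<epsilon>\<^sup>2))"
proof unfold_locales
  show "continuous_on UNIV (\<lambda>\<theta>. sampling_fun \<epsilon> k a c (\<theta>, j))" for j
    unfolding sampling_fun_def prod.case by (cases "j = 0") (simp_all add: continuous_intros)
  show "sampling_fun \<epsilon> k a c (frac \<theta>, j) = sampling_fun \<epsilon> k a c (\<theta>, j)" for \<theta> j
    by (simp add: sampling_fun_def fourier_char_frac)
  show "fourier_char k \<theta> * sampling_fun \<epsilon> k a c (\<theta>, j) =
      poly (smult (of_real (sqrt (1 - \<epsilon>\<^sup>2))) (if j = 0 then hi_poly k c a else lo_poly k c a))
        (fourier_char 1 \<theta>)" for \<theta> j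
    using poly_hi_poly[OF assms(2)] poly_lo_poly by (simp add: sampling_fun_def)
  show "fourier_char k \<theta> * cnj (sampling_fun \<epsilon> k a c (\<theta>, j)) =
      poly (smult (of_real (sqrt (1 - \<epsilon>\<^sup>2)))
        (if j = 0 then lo_poly k (cnj c) (cnj \<circ> a) else hi_poly k (cnj c) (cnj \<circ> a)))
        (fourier_char 1 \<theta>)" for \<theta> j
    using poly_hi_poly[OF assms(2)] poly_lo_poly by (simp add: cnj_sampling_fun)
qed (use assms in \<open>simp_all add: poly_lo_poly_0\<close>)

section \<open>Small perturbations and uniformity in \<open>z\<close>\<close>

theorem theorem2:
  fixes \<alpha> \<epsilon> :: real and k :: int and a :: "int \<Rightarrow> complex"
  assumes "\<alpha> \<notin> \<rat>"
    and "0 < \<epsilon>" and "\<epsilon> < 1 / sqrt 2"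
    and "1 \<le> k"
  shows "\<exists>lam1 > (0::real). \<forall>lam::complex. cmod lam < lam1 \<longrightarrow>
    sampling_fun \<epsilon> k a lam ` space circle_Z2 \<subseteq> ball 0 1 \<and>
    (\<exists>\<gamma>\<^sub>m > 0. (INF z\<in>sphere 0 1.
        lyapunov_exponent circle_Z2 (circle_Z2_shift \<alpha>) (sampling_fun \<epsilon> k a lam) z) \<ge> \<gamma>\<^sub>m)"
proof -
  define r where "r = sqrt (1 - \<epsilon>\<^sup>2)"
  define S where "S = (\<Sum>l = -k..k - 1. cmod (a l))"
  \<comment> \<open>The first entry keeps \<open>r * (1 + \<delta>)\<close> below 1, so that the
    values stay in the disk; the second yields \<open>D < r\<^sup>2\<close>. The second is positive
    because \<epsilon> is less than \<open>1 / sqrt 2\<close>.\<close>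
  define \<delta>0 where "\<delta>0 = min ((1 - r) / 2) ((2 * r\<^sup>2 - 1) / 2)"
  have "\<epsilon>\<^sup>2 < (1 / sqrt 2)\<^sup>2"
    using assms by (intro power_strict_mono) auto
  then have \<epsilon>: "0 < \<epsilon>\<^sup>2" "\<epsilon>\<^sup>2 < 1 / 2"
    using assms by (simp_all add: power_divide)
  then have r2: "r\<^sup>2 = 1 - \<epsilon>\<^sup>2" by (simp add: r_def)
  have r: "0 < r" "r < 1" using \<epsilon> by (simp_all add: r_def)
  have \<delta>0: "0 < \<delta>0" using r r2 \<epsilon> by (simp add: \<delta>0_def)
  have S: "0 \<le> S" by (simp add: S_def sum_nonneg)
  show ?thesis
  \<comment> \<open>\<open>S + 1\<close> instead of \<open>S\<close> avoids division by zero when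
    all coefficients vanish.\<close>
  proof (rule exI[of _ "\<delta>0 / (S + 1)"], intro conjI allI impI)
    show "0 < \<delta>0 / (S + 1)" using \<delta>0 S by simp
    fix lam :: complex
    assume "cmod lam < \<delta>0 / (S + 1)"
    then have "cmod lam * (S + 1) < \<delta>0" using S by (simp add: field_simps)
    define \<delta> where "\<delta> = cmod lam * S"
    have "\<delta> < \<delta>0" "0 \<le> \<delta>"
      using \<open>cmod lam * (S + 1) < \<delta>0\<close> S by (simp_all add: \<delta>_def algebra_simps) (smt (verit) norm_ge_zero)
    then have \<delta>: "2 * \<delta> < 1 - r" "2 * \<delta> < 2 * r\<^sup>2 - 1" by (simp_all add: \<delta>0_def)
    let ?f = "sampling_fun \<epsilon> k a lam"
    have upper: "cmod (?f x) \<le> r * (1 + \<delta>)" and lower: "r * (1 - \<delta>) \<le> cmod (?f x)" for x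
      using norm_sampling_fun_bounds[where \<epsilon> = \<epsilon> and k = k and a = a and c = lam and x = x] \<epsilon>
      by (simp_all add: r_def \<delta>_def S_def)
    have "r * \<delta> \<le> \<delta>" using r \<open>0 \<le> \<delta>\<close> by (simp add: mult_left_le_one_le)
    with \<delta> \<open>0 \<le> \<delta>\<close> have "r * (1 + \<delta>) < 1" by (simp add: algebra_simps)
    with upper have disk: "cmod (?f x) < 1" for x using le_less_trans by blast
    \<comment> \<open>The largest value of \<open>1 - (cmod (?f x))\<^sup>2\<close> that the lower
      bound on the modulus allows, the same for all points and all \<open>z\<close>.\<close>
    define D where "D = 1 - (r * (1 - \<delta>))\<^sup>2"
    have "\<delta> < 1" using \<delta> r by simp
    have "(cmod (?f x))\<^sup>2 \<ge> (r * (1 - \<delta>))\<^sup>2" for x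
      using lower r \<open>\<delta> < 1\<close> by (intro power_mono) auto
    then have D: "1 - (cmod (?f x))\<^sup>2 \<le> D" for x
      unfolding D_def by (simp add: algebra_simps)
    have "0 < 1 - (cmod (?f undefined))\<^sup>2"
      using disk[of undefined] by (simp add: abs_square_less_1)
    with D have D0: "0 < D" using less_le_trans by blast
    \<comment> \<open>Expanding the square and dropping the negative term quadratic in
      \<delta>.\<close>
    have "D \<le> 1 - r\<^sup>2 + 2 * (r\<^sup>2 * \<delta>)"
      using r \<open>0 \<le> \<delta>\<close> by (simp add: D_def power2_eq_square algebra_simps)
    also have "r\<^sup>2 * \<delta> \<le> \<delta>"
      using r2 \<epsilon> \<open>0 \<le> \<delta>\<close> by (intro mult_left_le_one_le) auto
    finally have "D < r\<^sup>2" using \<delta> by linarith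
    then have "sqrt D < r" using r real_less_rsqrt real_sqrt_less_iff[of D "r\<^sup>2"] by simp
    then have pos: "0 < ln r - ln (sqrt D)" using D0 r by simp
    have "ln r - ln (sqrt D) \<le> lyapunov_exponent circle_Z2 (circle_Z2_shift \<alpha>) ?f z"
      if "z \<in> sphere 0 1" for z
    proof -
      interpret szego_rotation_poly \<alpha> ?f z k
        "\<lambda>j. smult (of_real r) (if j = 0 then hi_poly k lam a else lo_poly k lam a)"
        "\<lambda>j. smult (of_real r)
          (if j = 0 then lo_poly k (cnj lam) (cnj \<circ> a) else hi_poly k (cnj lam) (cnj \<circ> a))" r
        unfolding r_def
        by (rule szego_rotation_poly_sampling_fun) (use \<epsilon> assms that disk in auto)
      show ?thesis by (rule lyapunov_exponent_ge[OF D])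
    qed
    \<comment> \<open>The bound is the same for every \<open>z\<close>, so it is a lower bound for
      the infimum and serves as the required positive constant.\<close>
    then have "ln r - ln (sqrt D) \<le> (INF z\<in>sphere 0 1.
        lyapunov_exponent circle_Z2 (circle_Z2_shift \<alpha>) ?f z)"
      by (intro cINF_greatest) (auto simp: sphere_eq_empty)
    with pos show "\<exists>\<gamma>\<^sub>m > 0. (INF z\<in>sphere 0 1.
        lyapunov_exponent circle_Z2 (circle_Z2_shift \<alpha>) ?f z) \<ge> \<gamma>\<^sub>m" by blast
    show "?f ` space circle_Z2 \<subseteq> ball 0 1" using disk by auto
  qed
qed

end
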